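(* Let $\mathcal{P}_{(1,1)}$ be the set of cylindric partitions with profile $(1,1)$. Then $$\sum_{\Lambda\in\mathcal{P}_{(1,1)}} q^{|\Lambda|}z^{\max(\Lambda)}u^{\mathrm{st}(\Lambda)}=\frac{((1-u)zq^2;q^2)_\infty\,((1-2u)zq;q^2)_\infty}{(zq;q)_\infty}.$$
   Context: A cylindric partition with profile $(1,1)$ is a pair $\Lambda=(\lambda^{(1)},\lambda^{(2)})$ of integer partitions (weakly decreasing, positive parts, missing entries regarded as $0$) such that $\lambda^{(1)}_j\ge\lambda^{(2)}_{j+1}$ and $\lambda^{(2)}_j\ge\lambda^{(1)}_{j+1}$ for all $j\ge1$. $|\Lambda|$ is the sum of all parts of both partitions; $\max(\Lambda)$ is the largest part appearing ($0$ if $\Lambda$ is empty); $\mathrm{st}(\Lambda)$ is the number of distinct positive integers appearing as parts in $\Lambda$. Notation: $(a;q)_\infty=\prod_{j\ge1}(1-aq^{j-1})$. The identity is between formal power series in $q$ with coefficients in $\mathbb{Z}[z,u]$. *)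

theory Defs
  imports "HOL-Analysis.Analysis" "HOL-Computational_Algebra.Formal_Power_Series"
begin

section \<open>Cylindric partitions of profile (1,1)\<close>

definition is_partition :: "nat list \<Rightarrow> bool" where
  "is_partition xs \<longleftrightarrow> sorted_wrt (\<ge>) xs \<and> (\<forall>x\<in>set xs. x > 0)"

text \<open>Parts are numbered from 0, so \<open>part xs j\<close> is the entry usually written with index \<open>j + 1\<close>.\<close>

definition part :: "nat list \<Rightarrow> nat \<Rightarrow> nat" where
  "part xs j = (if j < length xs then xs ! j else 0)"

definition cylindric_partitions_11 :: "(nat list \<times> nat list) set" where
  "cylindric_partitions_11 =
     {(xs, ys). is_partition xs \<and> is_partition ys \<and>
        (\<forall>j. part xs j \<ge> part ys (Suc j)) \<and> (\<forall>j. part ys j \<ge> part xs (Suc j))}"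

definition cp_parts :: "nat list \<times> nat list \<Rightarrow> nat set" where
  "cp_parts L = set (fst L) \<union> set (snd L)"

definition cp_weight :: "nat list \<times> nat list \<Rightarrow> nat" where
  "cp_weight L = sum_list (fst L) + sum_list (snd L)"

definition cp_max :: "nat list \<times> nat list \<Rightarrow> nat" where
  "cp_max L = (if cp_parts L = {} then 0 else Max (cp_parts L))"

definition cp_st :: "nat list \<times> nat list \<Rightarrow> nat" where
  "cp_st L = card (cp_parts L)"


section \<open>Power series in q over the polynomial ring in z and u\<close>

text \<open>The ring of integer polynomials in \<open>z\<close> and \<open>u\<close> is rendered as \<open>int poly poly\<close>:
  polynomials in \<open>z\<close> whose coefficients are polynomials in \<open>u\<close>.\<close>

definition q_var :: "int poly poly fps" where
  "q_var = fps_X"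

definition z_var :: "int poly poly fps" where
  "z_var = fps_const [:0, 1:]"

definition u_var :: "int poly poly fps" where
  "u_var = fps_const [:[:0, 1:]:]"

text \<open>The infinite product is taken in the coefficientwise topology on power series. It converges
  whenever \<open>a\<close> and \<open>q\<close> have zero constant term, as shown below; its
  constant term is then 1, so that \<open>fps_right_inverse (qpoch_inf a q) 1\<close> is its inverse.\<close>

definition qpoch_inf :: "'a::comm_ring_1 fps \<Rightarrow> 'a fps \<Rightarrow> 'a fps" where
  "qpoch_inf a q = (\<Prod>j. 1 - a * q ^ j)"

lemma qpoch_inf_has_prod:
  fixes a q :: "'a::idom fps"
  assumes a: "fps_nth a 0 = 0" and q: "fps_nth q 0 = 0"
  shows "(\<lambda>j. 1 - a * q ^ j) has_prod qpoch_inf a q"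
proof -
  define P where "P m = (\<Prod>j\<le>m. 1 - a * q ^ j)" for m
  define L where "L = Abs_fps (\<lambda>n. fps_nth (P n) n)"
  have small: "fps_nth (F * (a * q ^ j)) n = 0" if "n \<le> j" for F :: "'a fps" and j n
  proof -
    define a' where "a' = fps_shift 1 a"
    have a': "a = fps_X * a'"
      using a by (intro fps_ext) (auto simp: a'_def)
    define q' where "q' = fps_shift 1 q"
    have q': "q = fps_X * q'"
      using q by (intro fps_ext) (auto simp: q'_def)
    have eq: "F * (a * q ^ j) = fps_X ^ Suc j * (F * a' * q' ^ j)"
      by (simp add: a' q' algebra_simps)
    show ?thesis unfolding eq fps_X_power_mult_nth using that by simp
  qed
  have step: "fps_nth (P (Suc m)) n = fps_nth (P m) n" if "n \<le> Suc m" for m n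
  proof -
    have "P (Suc m) = P m - P m * (a * q ^ Suc m)"
      by (simp add: P_def algebra_simps)
    thus ?thesis using small[OF that, of "P m"] by (simp only: fps_sub_nth) simp
  qed
  have stable: "fps_nth (P m) n = fps_nth L n" if "n \<le> m" for m n
    using that by (induction m rule: dec_induct) (auto simp: L_def step)
  have lim: "P \<longlonglongrightarrow> L"
    by (rule tendsto_fpsI) (auto simp: eventually_sequentially intro: stable)
  have "fps_nth L 0 = 1" by (simp add: L_def P_def a)
  hence "L \<noteq> 0" by auto
  with lim have "raw_has_prod (\<lambda>j. 1 - a * q ^ j) 0 L"
    by (simp add: raw_has_prod_def P_def[abs_def])
  hence prod_L: "(\<lambda>j. 1 - a * q ^ j) has_prod L" by (simp add: has_prod_def)
  have "L = qpoch_inf a q" unfolding qpoch_inf_def by (rule has_prod_unique[OF prod_L])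
  with prod_L show ?thesis by simp
qed

end

(* Record a pair of partitions by its level pairs (a_k, b_k), the numbers of parts >= k. Being cylindric
   of profile (1,1) means |a_k - b_k| <= 1, so a cylindric partition is a multichain in the poset
   of nonzero pairs (a, b) with |a - b| <= 1. In this poset the rank a + b = n has one
   element if n is even and two incomparable ones if n is odd, and elements of different ranks are
   always comparable. The weight is the total rank, the maximum is the length of the multichain, and
   st counts its distinct elements, so rank n contributes the factor
   1 + c u z q^n / (1 - z q^n) with c = 1 or c = 2.
   Multichains are built up by their largest element (a, b), the pair of lengths: subtracting 1
   from all parts is a bijection from the cylindric partitions with lengths (a, b) to those with
   lengths at most (a, b), and st drops by 1 unless the lengths stay the same. *)

theory Submission
  imports Defs
begin

section \<open>Adding and deleting the first column of a Young diagram\<close>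

definition raise :: "nat \<Rightarrow> nat list \<Rightarrow> nat list" where
  "raise a xs = map Suc (xs @ replicate (a - length xs) 0)"

definition lower :: "nat list \<Rightarrow> nat list" where
  "lower xs = filter (\<lambda>x. 0 < x) (map (\<lambda>x. x - 1) xs)"

lemma length_raise: "length xs \<le> a \<Longrightarrow> length (raise a xs) = a"
  by (simp add: raise_def)

lemma length_lower_le: "length (lower xs) \<le> length xs"
  unfolding lower_def by (metis length_filter_le length_map)

lemma lower_raise:
  assumes "is_partition xs"
  shows "lower (raise a xs) = xs"
  using assms by (auto simp: is_partition_def raise_def lower_def filter_map o_def filter_id_conv)

lemma is_partition_raise: "is_partition xs \<Longrightarrow> is_partition (raise a xs)"
  by (auto simp: is_partition_def raise_def sorted_wrt_append sorted_wrt_map)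
     (auto simp: sorted_wrt_iff_nth_less)

lemma is_partition_lower: "is_partition xs \<Longrightarrow> is_partition (lower xs)"
  unfolding is_partition_def lower_def
  by (auto intro!: sorted_wrt_filter simp: sorted_wrt_map elim!: sorted_wrt_mono_rel[rotated])

lemma lower_eq_Nil: "\<forall>x\<in>set xs. x \<le> 1 \<Longrightarrow> lower xs = []"
  by (auto simp: lower_def filter_empty_conv)

text \<open>The entries that \<open>lower\<close> drops come from parts equal to 1, which end a
  weakly decreasing list; padding to the old length puts them back.\<close>

lemma raise_lower:
  assumes "is_partition xs"
  shows "raise (length xs) (lower xs) = xs"
  using assms
proof (induction xs)
  case Nil
  show ?case by (simp add: raise_def lower_def)
next
  case (Cons x xs)
  hence xs: "is_partition xs" and x: "x > 0" "\<forall>y\<in>set xs. y \<le> x \<and> y > 0"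
    by (auto simp: is_partition_def)
  show ?case
  proof (cases "x = 1")
    case True
    \<comment> \<open>A head equal to 1 forces all later parts to be 1, so \<open>lower\<close>
      leaves nothing and the padding rebuilds the whole list.\<close>
    with x have "\<forall>y\<in>set xs. y = 1" by force
    hence "xs = replicate (length xs) 1" by (metis replicate_length_same)
    hence "x # xs = replicate (Suc (length xs)) 1" using True by simp
    moreover have "lower (x # xs) = []"
      using True \<open>\<forall>y\<in>set xs. y = 1\<close> by (intro lower_eq_Nil) auto
    ultimately show ?thesis by (simp add: raise_def)
  next
    case False
    with x have "lower (x # xs) = (x - 1) # lower xs" by (simp add: lower_def)
    with Cons.IH[OF xs] x show ?thesis by (simp add: raise_def)
  qed
qed

lemma part_raise:
  "length xs \<le> a \<Longrightarrow> part (raise a xs) j = part xs j + (if j < a then 1 else 0)"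
  by (auto simp: part_def raise_def nth_append)

lemma part_lower:
  assumes "is_partition xs"
  shows "part (lower xs) j = part xs j - 1"
  using part_raise[OF length_lower_le, of xs j] raise_lower[OF assms]
  by (auto simp: part_def split: if_splits)

lemma sum_list_raise: "length xs \<le> a \<Longrightarrow> sum_list (raise a xs) = sum_list xs + a"
  using sum_list_Suc[of "\<lambda>x. x" xs] by (simp add: raise_def sum_list_replicate)

lemma set_raise:
  "set (raise a xs) = Suc ` set xs \<union> (if length xs < a then {1} else {})"
  by (auto simp: raise_def)

section \<open>Cylindric partitions with prescribed or bounded lengths\<close>

definition raise_pair :: "nat \<Rightarrow> nat \<Rightarrow> nat list \<times> nat list \<Rightarrow> nat list \<times> nat list" where
  "raise_pair a b L = (raise a (fst L), raise b (snd L))"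

text \<open>In the multichain picture, \<open>cp_shape a b\<close> fixes the largest element,
  \<open>cp_fit a b\<close> bounds it componentwise, and \<open>cp_upto n\<close> bounds its
  rank.\<close>

definition cp_fit :: "nat \<Rightarrow> nat \<Rightarrow> (nat list \<times> nat list) set" where
  "cp_fit a b = {L \<in> cylindric_partitions_11. length (fst L) \<le> a \<and> length (snd L) \<le> b}"

definition cp_shape :: "nat \<Rightarrow> nat \<Rightarrow> (nat list \<times> nat list) set" where
  "cp_shape a b = {L \<in> cylindric_partitions_11. length (fst L) = a \<and> length (snd L) = b}"

definition cp_upto :: "nat \<Rightarrow> (nat list \<times> nat list) set" where
  "cp_upto n = {L \<in> cylindric_partitions_11. length (fst L) + length (snd L) \<le> n}"

lemma part_pos: "is_partition xs \<Longrightarrow> j < length xs \<Longrightarrow> part xs j > 0"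
  by (auto simp: is_partition_def part_def)

text \<open>If \<open>xs\<close> exceeded \<open>ys\<close> by two or more parts, its positive part
  at index \<open>Suc (length ys)\<close> would be bounded by the missing entry of \<open>ys\<close>
  at index \<open>length ys\<close>, which is 0.\<close>

lemma cp_length_diff:
  assumes "L \<in> cylindric_partitions_11"
  shows "length (fst L) \<le> Suc (length (snd L))" "length (snd L) \<le> Suc (length (fst L))"
proof -
  obtain xs ys where L: "L = (xs, ys)" by force
  have 1: "length xs \<le> Suc (length ys)"
    if "is_partition xs" "\<forall>j. part ys j \<ge> part xs (Suc j)" for xs ys
  proof (rule ccontr)
    assume "\<not> ?thesis"
    hence "part xs (Suc (length ys)) > 0" using that(1) by (intro part_pos) auto
    moreover have "part ys (length ys) = 0" by (simp add: part_def)
    ultimately show False using that(2)[rule_format, of "length ys"] by simp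
  qed
  show "length (fst L) \<le> Suc (length (snd L))" "length (snd L) \<le> Suc (length (fst L))"
    using assms by (auto simp: L cylindric_partitions_11_def intro!: 1)
qed

text \<open>The added units respect the interlacing inequalities: \<open>Suc j < b\<close> implies
  \<open>j < a\<close> because \<open>b \<le> Suc a\<close>, and symmetrically.\<close>

lemma raise_pair_in_cp_shape:
  assumes L: "L \<in> cp_fit a b" and ab: "a \<le> Suc b" "b \<le> Suc a"
  shows "raise_pair a b L \<in> cp_shape a b"
proof -
  obtain xs ys where Lxy: "L = (xs, ys)" by force
  with L have *: "is_partition xs" "is_partition ys" "length xs \<le> a" "length ys \<le> b"
    "\<And>j. part xs j \<ge> part ys (Suc j)" "\<And>j. part ys j \<ge> part xs (Suc j)"
    by (auto simp: cp_fit_def cylindric_partitions_11_def)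
  show ?thesis
    unfolding cp_shape_def cylindric_partitions_11_def raise_pair_def
    using * ab by (auto simp: Lxy is_partition_raise part_raise length_raise le_SucI)
qed

lemma cp_shape_subset_raise: "cp_shape a b \<subseteq> raise_pair a b ` cp_fit a b"
proof
  fix L assume L: "L \<in> cp_shape a b"
  obtain xs ys where Lxy: "L = (xs, ys)" by force
  with L have *: "is_partition xs" "is_partition ys" "length xs = a" "length ys = b"
    "\<And>j. part xs j \<ge> part ys (Suc j)" "\<And>j. part ys j \<ge> part xs (Suc j)"
    by (auto simp: cp_shape_def cylindric_partitions_11_def)
  have "(lower xs, lower ys) \<in> cp_fit a b"
    using * length_lower_le[of xs] length_lower_le[of ys]
    by (auto simp: cp_fit_def cylindric_partitions_11_def is_partition_lower part_lower diff_le_mono)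
  moreover have "L = raise_pair a b (lower xs, lower ys)"
    using * raise_lower[of xs] raise_lower[of ys] by (simp add: raise_pair_def Lxy)
  ultimately show "L \<in> raise_pair a b ` cp_fit a b" by blast
qed

lemma raise_pair_image:
  assumes "a \<le> Suc b" "b \<le> Suc a"
  shows "raise_pair a b ` cp_fit a b = cp_shape a b"
  using raise_pair_in_cp_shape[OF _ assms] cp_shape_subset_raise by blast

lemma inj_on_raise_pair: "inj_on (raise_pair a b) (cp_fit a b)"
proof (rule inj_on_inverseI)
  fix L assume "L \<in> cp_fit a b"
  thus "(\<lambda>L. (lower (fst L), lower (snd L))) (raise_pair a b L) = L"
    by (auto simp: cp_fit_def cylindric_partitions_11_def raise_pair_def lower_raise)
qed

text \<open>A pair \<open>(a, b)\<close> that can be a pair of lengths lies above all other such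
  pairs with smaller sum, so every cylindric partition with fewer than \<open>a + b\<close> parts fits.\<close>

lemma cp_fit_eq:
  assumes "a \<le> Suc b" "b \<le> Suc a" "a + b = Suc n"
  shows "cp_fit a b = cp_shape a b \<union> cp_upto n"
  using assms cp_length_diff by (fastforce simp: cp_fit_def cp_shape_def cp_upto_def)

lemma cp_shape_disjoint_upto: "a + b = Suc n \<Longrightarrow> cp_shape a b \<inter> cp_upto n = {}"
  by (auto simp: cp_shape_def cp_upto_def)

section \<open>Weight, maximum and number of distinct parts under raising\<close>

lemma cp_parts_raise_pair:
  "cp_parts (raise_pair a b L) =
     Suc ` cp_parts L \<union> (if length (fst L) < a \<or> length (snd L) < b then {1} else {})"
  by (auto simp: cp_parts_def raise_pair_def set_raise)

lemma finite_cp_parts: "finite (cp_parts L)"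
  by (simp add: cp_parts_def)

lemma zero_notin_cp_parts: "L \<in> cylindric_partitions_11 \<Longrightarrow> 0 \<notin> cp_parts L"
  by (auto simp: cp_parts_def cylindric_partitions_11_def is_partition_def)

lemma cp_weight_raise_pair:
  "L \<in> cp_fit a b \<Longrightarrow> cp_weight (raise_pair a b L) = cp_weight L + (a + b)"
  by (auto simp: cp_fit_def cp_weight_def raise_pair_def sum_list_raise)

lemma cp_max_raise_pair:
  assumes "a + b > 0"
  shows "cp_max (raise_pair a b L) = Suc (cp_max L)"
proof (cases "cp_parts L = {}")
  case True
  \<comment> \<open>The maximum of the empty pair is 0 by convention; since
    \<open>a + b > 0\<close>, raising creates a part 1, so the maximum still grows by one.\<close>
  hence "fst L = []" "snd L = []" by (auto simp: cp_parts_def)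
  with assms True show ?thesis by (auto simp: cp_max_def cp_parts_raise_pair)
next
  case False
  have "Max (Suc ` cp_parts L) = Suc (Max (cp_parts L))"
    using False finite_cp_parts by (intro mono_Max_commute[symmetric]) (auto simp: mono_def)
  thus ?thesis using False finite_cp_parts[of L]
    by (auto simp: cp_max_def cp_parts_raise_pair Max_insert)
qed

text \<open>Shifting the values by one is injective. The value 1 is new, since 0 is not a part, and
  it occurs exactly when some list is padded.\<close>

lemma cp_st_raise_pair:
  assumes "L \<in> cylindric_partitions_11"
  shows "cp_st (raise_pair a b L) =
           cp_st L + (if length (fst L) < a \<or> length (snd L) < b then 1 else 0)"
  using zero_notin_cp_parts[OF assms] finite_cp_parts[of L]
  by (auto simp: cp_st_def card_insert_if cp_parts_raise_pair card_image)

lemma finite_cp_weight_le: "finite {L \<in> cylindric_partitions_11. cp_weight L \<le> n}"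
proof (rule finite_subset)
  let ?A = "{xs :: nat list. set xs \<subseteq> {..n} \<and> length xs \<le> n}"
  have *: "xs \<in> ?A" if "is_partition xs" "sum_list xs \<le> n" for xs
  proof -
    have "length xs \<le> sum_list xs"
      using that(1) by (induction xs) (auto simp: is_partition_def)
    moreover have "x \<le> sum_list xs" if "x \<in> set xs" for x
      using that by (intro member_le_sum_list) auto
    ultimately show ?thesis using that(2) by force
  qed
  show "{L \<in> cylindric_partitions_11. cp_weight L \<le> n} \<subseteq> ?A \<times> ?A"
    by (auto simp: cylindric_partitions_11_def cp_weight_def dest!: *)
  show "finite (?A \<times> ?A)" by (intro finite_cartesian_product finite_lists_length_le) auto
qed

lemma length_le_cp_weight:
  assumes "L \<in> cylindric_partitions_11"
  shows "length (fst L) + length (snd L) \<le> cp_weight L"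
proof -
  have "length xs \<le> sum_list xs" if "is_partition xs" for xs
    using that by (induction xs) (auto simp: is_partition_def)
  thus ?thesis using assms
    by (auto simp: cylindric_partitions_11_def cp_weight_def intro!: add_mono)
qed

section \<open>Generating functions of sets of cylindric partitions\<close>

definition cp_coeff :: "nat list \<times> nat list \<Rightarrow> int poly poly" where
  "cp_coeff L = [:0, 1:] ^ cp_max L * [:[:0, 1:]:] ^ cp_st L"

text \<open>Intended for sets of cylindric partitions, where \<open>finite_cp_weight_eq\<close>
  makes every coefficient a finite sum.\<close>

definition cp_gf :: "(nat list \<times> nat list) set \<Rightarrow> int poly poly fps" where
  "cp_gf S = Abs_fps (\<lambda>n. \<Sum>L | L \<in> S \<and> cp_weight L = n. cp_coeff L)"

lemma finite_cp_weight_eq: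
  "S \<subseteq> cylindric_partitions_11 \<Longrightarrow> finite {L \<in> S. cp_weight L = n}"
  by (rule finite_subset[OF _ finite_cp_weight_le[of n]]) auto

lemma cp_gf_Un:
  assumes "S \<subseteq> cylindric_partitions_11" "T \<subseteq> cylindric_partitions_11" "S \<inter> T = {}"
  shows "cp_gf (S \<union> T) = cp_gf S + cp_gf T"
proof (rule fps_ext)
  fix n
  have "{L. L \<in> S \<union> T \<and> cp_weight L = n} =
          {L \<in> S. cp_weight L = n} \<union> {L \<in> T. cp_weight L = n}"
    by auto
  thus "fps_nth (cp_gf (S \<union> T)) n = fps_nth (cp_gf S + cp_gf T) n"
    using assms by (simp add: cp_gf_def sum.union_disjoint finite_cp_weight_eq disjoint_iff)
qed

lemma cp_gf_image:
  assumes "inj_on f S"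
    and w: "\<And>L. L \<in> S \<Longrightarrow> cp_weight (f L) = cp_weight L + n"
    and c: "\<And>L. L \<in> S \<Longrightarrow> cp_coeff (f L) = c * cp_coeff L"
  shows "cp_gf (f ` S) = fps_const c * fps_X ^ n * cp_gf S"
proof (rule fps_ext)
  fix k
  \<comment> \<open>The form \<open>cp_weight L + n = k\<close> avoids truncated subtraction; for
    \<open>k < n\<close> the set is empty, as is the shifted coefficient.\<close>
  have "{L. L \<in> f ` S \<and> cp_weight L = k} = f ` {L \<in> S. cp_weight L + n = k}"
    using w by auto
  hence "fps_nth (cp_gf (f ` S)) k = (\<Sum>L | L \<in> S \<and> cp_weight L + n = k. cp_coeff (f L))"
    using assms(1) by (simp add: cp_gf_def sum.reindex inj_on_def)
  also have "\<dots> = c * (\<Sum>L | L \<in> S \<and> cp_weight L + n = k. cp_coeff L)"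
    unfolding sum_distrib_left by (rule sum.cong) (auto simp: c)
  also have "\<dots> = fps_nth (fps_const c * (fps_X ^ n * cp_gf S)) k"
  proof (cases "k < n")
    case False
    hence "{L. L \<in> S \<and> cp_weight L + n = k} = {L. L \<in> S \<and> cp_weight L = k - n}" by auto
    thus ?thesis using False by (simp add: cp_gf_def fps_X_power_mult_nth)
  next
    case True
    hence "{L. L \<in> S \<and> cp_weight L + n = k} = {}" by auto
    thus ?thesis using True by (simp only: fps_mult_left_const_nth fps_X_power_mult_nth) simp
  qed
  finally show "fps_nth (cp_gf (f ` S)) k = fps_nth (fps_const c * fps_X ^ n * cp_gf S) k"
    by (simp only: mult.assoc)
qed

text \<open>Deleting one copy of the largest element \<open>(a, b)\<close> leaves either the same
  shape (factor \<open>z q^(n+1)\<close>) or at most \<open>n\<close> parts (factor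
  \<open>u z q^(n+1)\<close>). The resulting equation for the shape series is linear, and the lemma
  is its solution with the denominator cleared.\<close>

lemma cp_gf_shape:
  assumes ab: "a \<le> Suc b" "b \<le> Suc a" and n: "a + b = Suc n"
  shows "cp_gf (cp_shape a b) * (1 - z_var * q_var ^ Suc n) =
           u_var * z_var * q_var ^ Suc n * cp_gf (cp_upto n)"
proof -
  have sub: "cp_shape a b \<subseteq> cp_fit a b" "cp_upto n \<subseteq> cp_fit a b"
    using cp_fit_eq[OF ab n] by auto
  have cp: "cp_fit a b \<subseteq> cylindric_partitions_11" by (auto simp: cp_fit_def)
  have inj: "inj_on (raise_pair a b) S" if "S \<subseteq> cp_fit a b" for S
    using inj_on_subset[OF inj_on_raise_pair that] .
  have img: "cp_shape a b = raise_pair a b ` cp_shape a b \<union> raise_pair a b ` cp_upto n"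
    using raise_pair_image[OF ab] cp_fit_eq[OF ab n] by auto
  have "cp_gf (cp_shape a b) =
          cp_gf (raise_pair a b ` cp_shape a b) + cp_gf (raise_pair a b ` cp_upto n)"
  proof (subst img, rule cp_gf_Un)
    have "cp_shape a b \<subseteq> cylindric_partitions_11" by (auto simp: cp_shape_def)
    thus "raise_pair a b ` cp_shape a b \<subseteq> cylindric_partitions_11"
      "raise_pair a b ` cp_upto n \<subseteq> cylindric_partitions_11"
      using img by blast+
    show "raise_pair a b ` cp_shape a b \<inter> raise_pair a b ` cp_upto n = {}"
      using inj_on_image_Int[OF inj_on_raise_pair sub] cp_shape_disjoint_upto[OF n] by simp
  qed
  moreover have "cp_gf (raise_pair a b ` cp_shape a b) =
      fps_const [:0, 1:] * fps_X ^ Suc n * cp_gf (cp_shape a b)"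
  proof (rule cp_gf_image[OF inj[OF sub(1)]])
    fix L assume L: "L \<in> cp_shape a b"
    show "cp_weight (raise_pair a b L) = cp_weight L + Suc n"
      using subsetD[OF sub(1) L] cp_weight_raise_pair n by simp
    show "cp_coeff (raise_pair a b L) = [:0, 1:] * cp_coeff L"
      using L n unfolding cp_coeff_def
      by (auto simp: cp_shape_def cp_max_raise_pair cp_st_raise_pair simp del: mult_pCons_left)
  qed
  moreover have "cp_gf (raise_pair a b ` cp_upto n) =
      fps_const ([:0, 1:] * [:[:0, 1:]:]) * fps_X ^ Suc n * cp_gf (cp_upto n)"
  proof (rule cp_gf_image[OF inj[OF sub(2)]])
    fix L assume L: "L \<in> cp_upto n"
    show "cp_weight (raise_pair a b L) = cp_weight L + Suc n"
      using subsetD[OF sub(2) L] cp_weight_raise_pair n by simp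
    \<comment> \<open>At most \<open>n\<close> parts cannot fill lengths with sum
      \<open>Suc n\<close>, so padding occurs and a new distinct part appears.\<close>
    have "length (fst L) < a \<or> length (snd L) < b" using L n by (auto simp: cp_upto_def)
    moreover have "L \<in> cylindric_partitions_11" using L by (auto simp: cp_upto_def)
    ultimately have "cp_max (raise_pair a b L) = Suc (cp_max L)"
      "cp_st (raise_pair a b L) = Suc (cp_st L)"
      using n by (simp_all add: cp_max_raise_pair cp_st_raise_pair)
    thus "cp_coeff (raise_pair a b L) = [:0, 1:] * [:[:0, 1:]:] * cp_coeff L"
      unfolding cp_coeff_def by (simp only: power_Suc mult_ac)
  qed
  ultimately have F: "cp_gf (cp_shape a b) = z_var * q_var ^ Suc n * cp_gf (cp_shape a b)
      + u_var * z_var * q_var ^ Suc n * cp_gf (cp_upto n)"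
    unfolding z_var_def u_var_def q_var_def fps_const_mult[symmetric] by (simp only: mult_ac)
  have "F * (1 - x) = y" if "F = x * F + y" for F x y :: "int poly poly fps"
    using that by algebra
  from this[OF F] show ?thesis .
qed

section \<open>Recurrences in the number of parts and the finite product\<close>

lemma cp_gf_upto_0: "cp_gf (cp_upto 0) = 1"
proof (rule fps_ext)
  fix n
  have *: "cp_upto 0 = {([], [])}"
    by (auto simp: cp_upto_def cylindric_partitions_11_def is_partition_def part_def)
  have "{L. L \<in> cp_upto 0 \<and> cp_weight L = n} = (if n = 0 then {([], [])} else {})"
    unfolding * by (auto simp: cp_weight_def)
  thus "fps_nth (cp_gf (cp_upto 0)) n = fps_nth 1 n"
    by (auto simp: cp_gf_def cp_coeff_def cp_max_def cp_st_def cp_parts_def)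
qed

text \<open>Lengths differing by at most 1 with sum \<open>2 * k + 1\<close> leave two shapes. With
  \<open>x = q^(2k+1)\<close> the numerator is \<open>1 - z x + 2 u z x\<close>.\<close>

lemma cp_gf_upto_odd:
  "cp_gf (cp_upto (2 * k + 1)) * (1 - z_var * q_var ^ (2 * k + 1)) =
     cp_gf (cp_upto (2 * k)) * (1 - (1 - 2 * u_var) * z_var * q_var ^ (2 * k + 1))"
proof -
  have split: "cp_upto (2 * k + 1) =
      cp_shape (Suc k) k \<union> (cp_shape k (Suc k) \<union> cp_upto (2 * k))"
    using cp_length_diff by (fastforce simp: cp_shape_def cp_upto_def)
  have "cp_gf (cp_upto (2 * k + 1)) =
      cp_gf (cp_shape (Suc k) k) + (cp_gf (cp_shape k (Suc k)) + cp_gf (cp_upto (2 * k)))"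
    unfolding split by (subst cp_gf_Un; (subst cp_gf_Un)?) (auto simp: cp_shape_def cp_upto_def)
  moreover have "cp_gf (cp_shape (Suc k) k) * (1 - z_var * q_var ^ (2 * k + 1)) =
      u_var * z_var * q_var ^ (2 * k + 1) * cp_gf (cp_upto (2 * k))"
    using cp_gf_shape[of "Suc k" k "2 * k"] by simp
  moreover have "cp_gf (cp_shape k (Suc k)) * (1 - z_var * q_var ^ (2 * k + 1)) =
      u_var * z_var * q_var ^ (2 * k + 1) * cp_gf (cp_upto (2 * k))"
    using cp_gf_shape[of k "Suc k" "2 * k"] by simp
  moreover have "G * (1 - z_var * x) = H * (1 - (1 - 2 * u_var) * z_var * x)"
    if "G = S + (T + H)" "S * (1 - z_var * x) = u_var * z_var * x * H"
      "T * (1 - z_var * x) = u_var * z_var * x * H" for G S T H x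
    using that by algebra
  ultimately show ?thesis by blast
qed

text \<open>An even sum leaves only the shape \<open>(Suc k, Suc k)\<close>, so the numerator is
  \<open>1 - z x + u z x\<close> with \<open>x = q^(2k+2)\<close>.\<close>

lemma cp_gf_upto_even:
  "cp_gf (cp_upto (2 * k + 2)) * (1 - z_var * q_var ^ (2 * k + 2)) =
     cp_gf (cp_upto (2 * k + 1)) * (1 - (1 - u_var) * z_var * q_var ^ (2 * k + 2))"
proof -
  have split: "cp_upto (2 * k + 2) = cp_shape (Suc k) (Suc k) \<union> cp_upto (2 * k + 1)"
    using cp_length_diff by (fastforce simp: cp_shape_def cp_upto_def)
  have "cp_gf (cp_upto (2 * k + 2)) =
      cp_gf (cp_shape (Suc k) (Suc k)) + cp_gf (cp_upto (2 * k + 1))"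
    unfolding split by (subst cp_gf_Un) (auto simp: cp_shape_def cp_upto_def)
  moreover have "cp_gf (cp_shape (Suc k) (Suc k)) * (1 - z_var * q_var ^ (2 * k + 2)) =
      u_var * z_var * q_var ^ (2 * k + 2) * cp_gf (cp_upto (2 * k + 1))"
    using cp_gf_shape[of "Suc k" "Suc k" "2 * k + 1"] by simp
  moreover have "G * (1 - z_var * x) = H * (1 - (1 - u_var) * z_var * x)"
    if "G = S + H" "S * (1 - z_var * x) = u_var * z_var * x * H" for G S H x
    using that by algebra
  ultimately show ?thesis by blast
qed

text \<open>Each step in \<open>m\<close> uses one odd and one even recurrence, so two factors of
  the denominator match one factor of each numerator product.\<close>

lemma cp_gf_upto_prod:
  "cp_gf (cp_upto (2 * m)) * (\<Prod>k<2 * m. 1 - z_var * q_var * q_var ^ k) =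
     (\<Prod>k<m. 1 - (1 - u_var) * z_var * q_var ^ 2 * (q_var ^ 2) ^ k) *
     (\<Prod>k<m. 1 - (1 - 2 * u_var) * z_var * q_var * (q_var ^ 2) ^ k)"
proof (induction m)
  case 0
  show ?case by (simp add: cp_gf_upto_0)
next
  case (Suc m)
  define A where "A = (\<Prod>k<2 * m. 1 - z_var * q_var * q_var ^ k)"
  define B where "B = (\<Prod>k<m. 1 - (1 - u_var) * z_var * q_var ^ 2 * (q_var ^ 2) ^ k)"
  define C where "C = (\<Prod>k<m. 1 - (1 - 2 * u_var) * z_var * q_var * (q_var ^ 2) ^ k)"
  have IH: "cp_gf (cp_upto (2 * m)) * A = B * C"
    using Suc.IH by (simp only: A_def B_def C_def)
  have A: "(\<Prod>k<2 * Suc m. 1 - z_var * q_var * q_var ^ k) =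
      A * (1 - z_var * q_var ^ (2 * m + 1)) * (1 - z_var * q_var ^ (2 * m + 2))"
    by (simp add: A_def mult_ac power_add power2_eq_square)
  \<comment> \<open>Rewrites the exponents of the recurrences in the base \<open>q_var ^ 2\<close>
    of the numerator products.\<close>
  have "q_var ^ (2 * m + 2) = q_var ^ 2 * (q_var ^ 2) ^ m"
    "q_var ^ (2 * m + 1) = q_var * (q_var ^ 2) ^ m"
    by (simp_all add: power_add power_mult flip: power2_eq_square)
  hence B: "(\<Prod>k<Suc m. 1 - (1 - u_var) * z_var * q_var ^ 2 * (q_var ^ 2) ^ k) =
      B * (1 - (1 - u_var) * z_var * q_var ^ (2 * m + 2))"
    and C: "(\<Prod>k<Suc m. 1 - (1 - 2 * u_var) * z_var * q_var * (q_var ^ 2) ^ k) =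
      C * (1 - (1 - 2 * u_var) * z_var * q_var ^ (2 * m + 1))"
    by (simp_all only: B_def C_def prod.lessThan_Suc mult.assoc)
  have "G'' * (A * x * y) = B * v * (C * w)"
    if "G'' * y = G' * v" "G' * x = G * w" "G * A = B * C"
    for G G' G'' x y v w :: "int poly poly fps"
    using that by algebra
  from this[OF cp_gf_upto_even cp_gf_upto_odd IH] show ?case
    unfolding A B C by simp
qed

section \<open>Passage to the limit\<close>

text \<open>Every part contributes at least 1 to the weight, so the coefficient at \<open>n\<close>
  no longer changes once \<open>n\<close> parts are allowed.\<close>

lemma cp_gf_upto_tendsto: "(\<lambda>n. cp_gf (cp_upto n)) \<longlonglongrightarrow> cp_gf cylindric_partitions_11"
proof (rule tendsto_fpsI)
  fix n
  have "fps_nth (cp_gf (cp_upto m)) n = fps_nth (cp_gf cylindric_partitions_11) n" if "m \<ge> n" for m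
  proof -
    have "{L. L \<in> cp_upto m \<and> cp_weight L = n} =
            {L. L \<in> cylindric_partitions_11 \<and> cp_weight L = n}"
      using that length_le_cp_weight by (fastforce simp: cp_upto_def)
    thus ?thesis by (simp add: cp_gf_def)
  qed
  thus "\<forall>\<^sub>F m in sequentially. fps_nth (cp_gf (cp_upto m)) n = fps_nth (cp_gf cylindric_partitions_11) n"
    by (auto simp: eventually_sequentially)
qed

text \<open>Coefficient \<open>n\<close> of a product depends only on coefficients
  \<open>0..n\<close> of the factors, and these finitely many are eventually all equal to their
  limits.\<close>

lemma tendsto_mult_fps:
  fixes F G :: "'a \<Rightarrow> 'b::ring_1 fps"
  assumes "(F \<longlongrightarrow> f) \<A>" "(G \<longlongrightarrow> g) \<A>"
  shows "((\<lambda>x. F x * G x) \<longlongrightarrow> f * g) \<A>"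
proof (rule tendsto_fpsI)
  fix n
  have "\<forall>\<^sub>F x in \<A>. \<forall>k\<in>{..n}. fps_nth (F x) k = fps_nth f k"
    "\<forall>\<^sub>F x in \<A>. \<forall>k\<in>{..n}. fps_nth (G x) k = fps_nth g k"
    using assms by (simp_all add: tendsto_fps_iff eventually_ball_finite)
  thus "\<forall>\<^sub>F x in \<A>. fps_nth (F x * G x) n = fps_nth (f * g) n"
    by eventually_elim (simp add: fps_mult_nth)
qed

lemma tendsto_qpoch_inf:
  fixes a q :: "'a::idom fps"
  assumes "fps_nth a 0 = 0" "fps_nth q 0 = 0"
  shows "(\<lambda>n. \<Prod>k<n. 1 - a * q ^ k) \<longlonglongrightarrow> qpoch_inf a q"
  by (rule has_prod_imp_tendsto'[OF qpoch_inf_has_prod[OF assms]])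

text \<open>Constant term 1 is what makes \<open>fps_right_inverse\<close> with starting value 1 an
  actual inverse in the final quotient.\<close>

lemma qpoch_inf_nth_0:
  fixes a q :: "'a::idom fps"
  assumes "fps_nth a 0 = 0" "fps_nth q 0 = 0"
  shows "fps_nth (qpoch_inf a q) 0 = 1"
proof -
  have "\<forall>\<^sub>F n in sequentially. fps_nth (\<Prod>k<n. 1 - a * q ^ k) 0 = fps_nth (qpoch_inf a q) 0"
    using tendsto_qpoch_inf[OF assms] by (simp add: tendsto_fps_iff)
  moreover have "fps_nth (\<Prod>k<n. 1 - a * q ^ k) 0 = 1" for n
    by (induction n) (simp_all add: assms)
  ultimately show ?thesis by auto
qed

text \<open>Both sides are limits of one sequence, whose terms \<open>cp_gf_upto_prod\<close> writes
  in two ways.\<close>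

lemma cp_gf_mult_qpoch_inf:
  "cp_gf cylindric_partitions_11 * qpoch_inf (z_var * q_var) q_var =
     qpoch_inf ((1 - u_var) * z_var * q_var ^ 2) (q_var ^ 2) *
     qpoch_inf ((1 - 2 * u_var) * z_var * q_var) (q_var ^ 2)"
    (is "?lhs = ?rhs")
proof (rule LIMSEQ_unique)
  let ?G = "\<lambda>m. cp_gf (cp_upto (2 * m)) * (\<Prod>k<2 * m. 1 - z_var * q_var * q_var ^ k)"
  have q0: "fps_nth q_var 0 = 0" "fps_nth (q_var ^ 2) 0 = 0" by (simp_all add: q_var_def)
  \<comment> \<open>The finite product formula covers even bounds only, so limits are taken along
    \<open>2 * m\<close>.\<close>
  have double: "filterlim (\<lambda>m::nat. 2 * m) at_top at_top"
    by (rule filterlim_subseq) (simp add: strict_mono_def)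
  show "?G \<longlonglongrightarrow> ?lhs"
    by (intro tendsto_mult_fps filterlim_compose[OF _ double] cp_gf_upto_tendsto
          tendsto_qpoch_inf) (simp_all add: q0)
  show "?G \<longlonglongrightarrow> ?rhs"
    unfolding cp_gf_upto_prod by (intro tendsto_mult_fps tendsto_qpoch_inf) (simp_all add: q0)
qed

text \<open>Links coefficientwise counting to the infinite sum of monomials: a finite partial sum
  has the right coefficient at \<open>n\<close> as soon as it contains the finite set
  \<open>?W\<close> of all members of weight \<open>n\<close>.\<close>

lemma cp_gf_has_sum:
  assumes "S \<subseteq> cylindric_partitions_11"
  shows "((\<lambda>L. q_var ^ cp_weight L * z_var ^ cp_max L * u_var ^ cp_st L) has_sum cp_gf S) S"
  unfolding has_sum_def
proof (rule tendsto_fpsI)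
  fix n
  let ?f = "\<lambda>L. q_var ^ cp_weight L * z_var ^ cp_max L * u_var ^ cp_st L"
  let ?W = "{L. L \<in> S \<and> cp_weight L = n}"
  have f: "?f L = fps_X ^ cp_weight L * fps_const (cp_coeff L)" for L
    by (simp add: q_var_def z_var_def u_var_def cp_coeff_def fps_const_power fps_const_mult
          mult.assoc del: mult_pCons_left)
  have f_nth: "fps_nth (?f L) n = (if cp_weight L = n then cp_coeff L else 0)" for L
    unfolding f by simp
  have "fps_nth (sum ?f X) n = fps_nth (cp_gf S) n" if X: "finite X" "?W \<subseteq> X" "X \<subseteq> S" for X
  proof -
    have "fps_nth (sum ?f X) n = (\<Sum>L\<in>X. if cp_weight L = n then cp_coeff L else 0)"
      by (simp only: fps_sum_nth f_nth)
    also have "\<dots> = sum cp_coeff {L \<in> X. cp_weight L = n}"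
      using X(1) by (simp add: sum.inter_filter)
    also have "{L \<in> X. cp_weight L = n} = ?W" using X by auto
    finally show ?thesis by (simp add: cp_gf_def)
  qed
  moreover have "finite ?W" using finite_cp_weight_eq[OF assms] .
  ultimately show "\<forall>\<^sub>F X in finite_subsets_at_top S. fps_nth (sum ?f X) n = fps_nth (cp_gf S) n"
    unfolding eventually_finite_subsets_at_top by (intro exI[of _ ?W]) auto
qed

theorem mainTheorem2:
  shows "((\<lambda>L. q_var ^ cp_weight L * z_var ^ cp_max L * u_var ^ cp_st L) has_sum
            (qpoch_inf ((1 - u_var) * z_var * q_var ^ 2) (q_var ^ 2)
              * qpoch_inf ((1 - 2 * u_var) * z_var * q_var) (q_var ^ 2)
              * fps_right_inverse (qpoch_inf (z_var * q_var) q_var) 1))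
          cylindric_partitions_11"
proof -
  have "qpoch_inf (z_var * q_var) q_var * fps_right_inverse (qpoch_inf (z_var * q_var) q_var) 1 = 1"
    by (intro fps_right_inverse) (simp add: qpoch_inf_nth_0 q_var_def)
  hence "cp_gf cylindric_partitions_11 =
      cp_gf cylindric_partitions_11 * qpoch_inf (z_var * q_var) q_var *
        fps_right_inverse (qpoch_inf (z_var * q_var) q_var) 1"
    by (simp only: mult.assoc mult_1_right)
  with cp_gf_has_sum[OF order_refl] show ?thesis by (simp only: cp_gf_mult_qpoch_inf)
qed

end
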